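(* Let $K:\mathbb{C}^m\times\mathbb{C}^m\to\mathbb{C}$ be a positive definite kernel with reproducing kernel Hilbert space $\mathcal{H}(K)$ and feature map $\Phi:\mathbb{C}^m\to\mathcal{H}(K)$, and let $x_1,\dots,x_n\in\mathbb{C}^m$. Let $(\delta_j)_{j=1}^n$ be the standard basis of $\mathbb{C}^n$. Let $L:\mathcal{H}(K)\to\mathbb{C}^n$ be the analysis operator $Lf=\sum_{j=1}^n\langle\Phi(x_j),f\rangle_{\mathcal{H}(K)}\,\delta_j$, with adjoint $L^*:\mathbb{C}^n\to\mathcal{H}(K)$. Define $A:\mathbb{C}^n\to\mathcal{H}(K)$ by $A\delta_j=\Phi(x_j)$, extended linearly. Then the adjoint operator $A^{*}:\mathcal{H}(K)\to\mathbb{C}^n$ is $$A^{*}h=\left(\langle\Phi(x_j),h\rangle_{\mathcal{H}(K)}\right)_{j=1}^{n}\in\mathbb{C}^n,\qquad h\in\mathcal{H}(K).$$ That is, $A=L^{*}$ and $A^{*}=L$.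
   Context: A positive definite kernel on a set $S$ is a function $K:S\times S\to\mathbb{C}$ with $\sum_{i,j=1}^{N}\overline{c_i}c_jK(x_i,x_j)\ge 0$ for all $N\in\mathbb{N}$, $x_1,\dots,x_N\in S$, $c_1,\dots,c_N\in\mathbb{C}$. Inner products are conjugate linear in the first variable. $\mathcal{H}(K)$ is the Hilbert space of functions on $S$ obtained by completing $\mathrm{span}\{K_x:=K(\cdot,x):x\in S\}$ in the inner product $\langle\sum c_iK_{x_i},\sum d_jK_{x_j}\rangle=\sum\overline{c_i}d_jK(x_i,x_j)$. A feature map is a map $\Phi:S\to\mathcal{H}(K)$ with $K(x,y)=\langle\Phi(x),\Phi(y)\rangle_{\mathcal{H}(K)}$ for all $x,y\in S$. *)

theory Defs
  imports "HOL-Analysis.Analysis" "HOL-Library.Function_Algebras"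
begin

definition positive_definite_kernel :: "('s \<Rightarrow> 's \<Rightarrow> complex) \<Rightarrow> bool" where
  "positive_definite_kernel K \<longleftrightarrow>
     (\<forall>(N::nat) (x :: nat \<Rightarrow> 's) (c :: nat \<Rightarrow> complex).
        (\<Sum>i<N. \<Sum>j<N. cnj (c i) * c j * K (x i) (x j)) \<in> \<real>\<^sub>\<ge>\<^sub>0)"

definition kernel_comb ::
    "('s \<Rightarrow> 's \<Rightarrow> complex) \<Rightarrow> 's set \<Rightarrow> ('s \<Rightarrow> complex) \<Rightarrow> 's \<Rightarrow> complex" where
  "kernel_comb K F c = (\<lambda>y. \<Sum>x\<in>F. c x * K y x)"

definition kernel_span :: "('s \<Rightarrow> 's \<Rightarrow> complex) \<Rightarrow> ('s \<Rightarrow> complex) set" where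
  "kernel_span K = {kernel_comb K F c | F c. finite F}"

text \<open>For a positive definite kernel the double sum does not depend on how \<open>f\<close> and \<open>g\<close> are
  written as combinations of kernel sections, so the description determines a unique number.\<close>

definition kernel_span_inner ::
    "('s \<Rightarrow> 's \<Rightarrow> complex) \<Rightarrow> ('s \<Rightarrow> complex) \<Rightarrow> ('s \<Rightarrow> complex) \<Rightarrow> complex" where
  "kernel_span_inner K f g =
     (THE z. \<forall>F c G d. finite F \<and> finite G \<and> f = kernel_comb K F c \<and> g = kernel_comb K G d \<longrightarrow>
        z = (\<Sum>x\<in>F. \<Sum>y\<in>G. cnj (c x) * d y * K x y))"

definition kernel_span_norm :: "('s \<Rightarrow> 's \<Rightarrow> complex) \<Rightarrow> ('s \<Rightarrow> complex) \<Rightarrow> real" where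
  "kernel_span_norm K f = sqrt (Re (kernel_span_inner K f f))"

definition kernel_span_Cauchy ::
    "('s \<Rightarrow> 's \<Rightarrow> complex) \<Rightarrow> (nat \<Rightarrow> 's \<Rightarrow> complex) \<Rightarrow> bool" where
  "kernel_span_Cauchy K u \<longleftrightarrow> range u \<subseteq> kernel_span K \<and>
     (\<forall>e>0. \<exists>M. \<forall>m\<ge>M. \<forall>n\<ge>M. kernel_span_norm K (u m - u n) < e)"

text \<open>The completion of the span is realised as a space of functions: by the Cauchy-Schwarz
  inequality a Cauchy sequence in the span converges pointwise, and two Cauchy sequences
  define the same point of the completion iff they have the same pointwise limit. An element of
  the completion is therefore identified with the pointwise limit of its Cauchy sequences.\<close>

definition rkhs_approx ::
    "('s \<Rightarrow> 's \<Rightarrow> complex) \<Rightarrow> (nat \<Rightarrow> 's \<Rightarrow> complex) \<Rightarrow> ('s \<Rightarrow> complex) \<Rightarrow> bool" where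
  "rkhs_approx K u f \<longleftrightarrow> kernel_span_Cauchy K u \<and> (\<forall>y. (\<lambda>n. u n y) \<longlonglongrightarrow> f y)"

definition rkhs :: "('s \<Rightarrow> 's \<Rightarrow> complex) \<Rightarrow> ('s \<Rightarrow> complex) set" where
  "rkhs K = {f. \<exists>u. rkhs_approx K u f}"

definition rkhs_inner ::
    "('s \<Rightarrow> 's \<Rightarrow> complex) \<Rightarrow> ('s \<Rightarrow> complex) \<Rightarrow> ('s \<Rightarrow> complex) \<Rightarrow> complex" where
  "rkhs_inner K f g =
     (THE z. \<forall>u v. rkhs_approx K u f \<and> rkhs_approx K v g \<longrightarrow>
        (\<lambda>n. kernel_span_inner K (u n) (v n)) \<longlonglongrightarrow> z)"

definition feature_map :: "('s \<Rightarrow> 's \<Rightarrow> complex) \<Rightarrow> ('s \<Rightarrow> 's \<Rightarrow> complex) \<Rightarrow> bool" where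
  "feature_map K \<Phi> \<longleftrightarrow> range \<Phi> \<subseteq> rkhs K \<and> (\<forall>x y. K x y = rkhs_inner K (\<Phi> x) (\<Phi> y))"

definition cvec_inner :: "complex ^ 'n \<Rightarrow> complex ^ 'n \<Rightarrow> complex" where
  "cvec_inner a b = (\<Sum>j\<in>UNIV. cnj (a $ j) * b $ j)"

text \<open>The adjoint of a bounded operator \<open>T\<close> from the Hilbert space with carrier \<open>V\<close> and inner
  product \<open>ipV\<close> to a Hilbert space with inner product \<open>ipW\<close>: its value at \<open>w\<close> is the
  unique (by the Riesz representation theorem) \<open>v\<close> in \<open>V\<close> with
  \<open>ipV u v = ipW (T u) w\<close> for all \<open>u\<close> in \<open>V\<close>.\<close>

definition hilbert_adjoint ::
    "'v set \<Rightarrow> ('v \<Rightarrow> 'v \<Rightarrow> complex) \<Rightarrow> ('w \<Rightarrow> 'w \<Rightarrow> complex) \<Rightarrow> ('v \<Rightarrow> 'w) \<Rightarrow> 'w \<Rightarrow> 'v" where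
  "hilbert_adjoint V ipV ipW T w = (THE v. v \<in> V \<and> (\<forall>u\<in>V. ipV u v = ipW (T u) w))"

definition analysis_operator ::
    "('s \<Rightarrow> 's \<Rightarrow> complex) \<Rightarrow> ('s \<Rightarrow> 's \<Rightarrow> complex) \<Rightarrow> ('n::finite \<Rightarrow> 's) \<Rightarrow>
     ('s \<Rightarrow> complex) \<Rightarrow> complex ^ 'n" where
  "analysis_operator K \<Phi> x f = (\<Sum>j\<in>UNIV. rkhs_inner K (\<Phi> (x j)) f *s axis j 1)"

end

theory Submission
  imports Defs
begin

text \<open>
  The operators \<open>A a = (\<Sum>j. a $ j * \<Phi> (x j))\<close> and \<open>L\<close> are adjoint because the inner product of
  \<open>rkhs K\<close> is sesquilinear and Hermitian:
  \<open>rkhs_inner K (A a) h = (\<Sum>j. cnj (a $ j) * rkhs_inner K (\<Phi> (x j)) h) = cvec_inner a (L h)\<close>.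
  An adjoint is given by a definite description, so uniqueness is needed too. On \<open>complex ^ 'n\<close> one
  tests against the standard basis; on \<open>rkhs K\<close> one tests against the kernel sections, which
  separate points by the reproducing property \<open>rkhs_inner K (\<lambda>z. K z y) f = f y\<close>.

  The real work is to see that the inner products are well defined. On the span, the double
  sum that defines the inner product of \<open>f = kernel_comb K F c\<close> and \<open>g = kernel_comb K G d\<close> equals
  \<open>\<Sum>x\<in>F. cnj (c x) * g x\<close> as well as \<open>\<Sum>y\<in>G. d y * cnj (f y)\<close> (as \<open>K\<close> is Hermitian); the first
  expression does not depend on the representation of \<open>g\<close>, the second not on that of \<open>f\<close>. On the
  completion, the Cauchy-Schwarz inequality makes \<open>kernel_span_inner K (u n) (v n)\<close> a Cauchy
  sequence, and the key lemma \<open>inner_tendsto_0\<close> shows that its limit depends on the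
  pointwise limits of \<open>u\<close> and \<open>v\<close> only.
\<close>

section \<open>Positive definite kernels\<close>

text \<open>Positivity includes that the quadratic form at the points \<open>x, y\<close> is real. The coefficient pair
  \<open>(1, 1)\<close> then gives \<open>Im (K x y) + Im (K y x) = 0\<close>, and \<open>(1, \<i>)\<close> gives \<open>Re (K x y) = Re (K y x)\<close>.\<close>

lemma pd_kernel_Hermitian:
  assumes pd: "positive_definite_kernel K"
  shows "K y x = cnj (K x y)"
proof -
  have two: "cnj a * a * K x x + cnj a * b * K x y + (cnj b * a * K y x + cnj b * b * K y y)
      \<in> \<real>\<^sub>\<ge>\<^sub>0" for a b
  proof -
    have "(\<Sum>i<2::nat. \<Sum>j<2::nat. cnj (((\<lambda>_. b)(0 := a)) i) * ((\<lambda>_. b)(0 := a)) j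
             * K (((\<lambda>_. y)(0 := x)) i) (((\<lambda>_. y)(0 := x)) j)) \<in> \<real>\<^sub>\<ge>\<^sub>0"
      using pd[unfolded positive_definite_kernel_def, rule_format,
          of "(\<lambda>_. b)(0 := a)" "(\<lambda>_. y)(0 := x)" 2] .
    then show ?thesis
      by (simp add: numeral_2_eq_2)
  qed
  have "Im (K x x) = 0" "Im (K y y) = 0"
    using two[of 1 0] two[of 0 1] by (auto simp: complex_nonneg_Reals_iff)
  moreover have "Im (K x x) + Im (K x y) + (Im (K y x) + Im (K y y)) = 0"
    using two[of 1 1] by (auto simp: complex_nonneg_Reals_iff)
  moreover have "Im (K x x) + Re (K x y) + (- Re (K y x) + Im (K y y)) = 0"
    using two[of 1 \<i>] by (auto simp: complex_nonneg_Reals_iff)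
  ultimately show ?thesis
    by (simp add: complex_eq_iff)
qed

lemma pd_kernel_sum_nonneg:
  assumes pd: "positive_definite_kernel K" and "finite F"
  shows "(\<Sum>x\<in>F. \<Sum>y\<in>F. cnj (c x) * c y * K x y) \<in> \<real>\<^sub>\<ge>\<^sub>0"
proof -
  obtain h where h: "bij_betw h {..<card F} F"
    using \<open>finite F\<close> ex_bij_betw_nat_finite[of F] by (auto simp: atLeast0LessThan)
  have "(\<Sum>x\<in>F. \<Sum>y\<in>F. cnj (c x) * c y * K x y)
      = (\<Sum>i<card F. \<Sum>j<card F. cnj (c (h i)) * c (h j) * K (h i) (h j))"
    by (simp add: sum.reindex_bij_betw[OF h, symmetric])
  also have "\<dots> \<in> \<real>\<^sub>\<ge>\<^sub>0"
    using pd[unfolded positive_definite_kernel_def, rule_format, of "\<lambda>i. c (h i)" h "card F"] .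
  finally show ?thesis .
qed

section \<open>The span of the kernel sections\<close>

lemma kernel_comb_in_span: "finite F \<Longrightarrow> kernel_comb K F c \<in> kernel_span K"
  by (auto simp: kernel_span_def)

lemma kernel_section_in_span: "(\<lambda>z. K z y) \<in> kernel_span K"
  using kernel_comb_in_span[of "{y}" K "\<lambda>_. 1"] by (simp add: kernel_comb_def)

lemma kernel_span_scale:
  assumes "f \<in> kernel_span K" shows "(\<lambda>y. a * f y) \<in> kernel_span K"
proof -
  obtain F c where F: "finite F" "f = kernel_comb K F c"
    using assms by (auto simp: kernel_span_def)
  then have "(\<lambda>y. a * f y) = kernel_comb K F (\<lambda>x. a * c x)"
    by (simp add: kernel_comb_def sum_distrib_left mult.assoc)
  with F show ?thesis
    by (simp add: kernel_comb_in_span)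
qed

lemma kernel_span_add:
  assumes "f \<in> kernel_span K" "g \<in> kernel_span K" shows "f + g \<in> kernel_span K"
proof -
  obtain F c G d where F: "finite F" "f = kernel_comb K F c" and G: "finite G" "g = kernel_comb K G d"
    using assms by (auto simp: kernel_span_def)
  have "kernel_comb K F c = kernel_comb K (F \<union> G) (\<lambda>x. if x \<in> F then c x else 0)"
    "kernel_comb K G d = kernel_comb K (F \<union> G) (\<lambda>x. if x \<in> G then d x else 0)"
    using F G by (auto simp: kernel_comb_def fun_eq_iff intro!: sum.mono_neutral_cong_left)
  then have "f + g = kernel_comb K (F \<union> G)
      (\<lambda>x. (if x \<in> F then c x else 0) + (if x \<in> G then d x else 0))"
    unfolding F G by (simp add: kernel_comb_def fun_eq_iff sum.distrib algebra_simps)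
  then show ?thesis
    using F G by (simp add: kernel_comb_in_span)
qed

lemma kernel_span_diff:
  assumes "f \<in> kernel_span K" "g \<in> kernel_span K" shows "f - g \<in> kernel_span K"
proof -
  have "f - g = f + (\<lambda>y. - 1 * g y)"
    by (simp add: fun_eq_iff)
  then show ?thesis
    using kernel_span_add kernel_span_scale assms by metis
qed

context
  fixes K :: "'s \<Rightarrow> 's \<Rightarrow> complex"
  assumes pd: "positive_definite_kernel K"
begin

text \<open>For \<open>f = kernel_comb K F c\<close>, the double sum is \<open>\<Sum>x\<in>F. cnj (c x) * g x\<close>, which only sees \<open>g\<close> as a function; by the Hermitian
  symmetry of \<open>K\<close> it also only sees \<open>f\<close> as a function. So the definite description in the
  definition of the inner product picks out exactly this number.\<close>

lemma kernel_span_inner_comb_left: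
  assumes "finite F" "g \<in> kernel_span K"
  shows "kernel_span_inner K (kernel_comb K F c) g = (\<Sum>x\<in>F. cnj (c x) * g x)"
proof -
  have left: "(\<Sum>x\<in>F'. \<Sum>y\<in>G. cnj (c' x) * d y * K x y)
      = (\<Sum>x\<in>F'. cnj (c' x) * kernel_comb K G d x)" for F' G c' d
    by (simp add: kernel_comb_def sum_distrib_left mult.assoc)
  have right: "(\<Sum>x\<in>F'. \<Sum>y\<in>G. cnj (c' x) * d y * K x y)
      = (\<Sum>y\<in>G. d y * cnj (kernel_comb K F' c' y))" for F' G c' d
    by (subst sum.swap)
       (auto simp: kernel_comb_def sum_distrib_left mult.assoc mult.left_commute
          pd_kernel_Hermitian[OF pd, symmetric] intro!: sum.cong)
  obtain G d where G: "finite G" "g = kernel_comb K G d"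
    using assms by (auto simp: kernel_span_def)
  show ?thesis
    unfolding kernel_span_inner_def
  proof (rule the_equality)
    show "\<forall>F' c' G' d'. finite F' \<and> finite G' \<and> kernel_comb K F c = kernel_comb K F' c' \<and>
        g = kernel_comb K G' d' \<longrightarrow>
        (\<Sum>x\<in>F. cnj (c x) * g x) = (\<Sum>x\<in>F'. \<Sum>y\<in>G'. cnj (c' x) * d' y * K x y)"
    proof (intro allI impI, elim conjE)
      fix F' c' G' d'
      assume f': "kernel_comb K F c = kernel_comb K F' c'" and g': "g = kernel_comb K G' d'"
      have "(\<Sum>x\<in>F. cnj (c x) * g x) = (\<Sum>x\<in>F. \<Sum>y\<in>G'. cnj (c x) * d' y * K x y)"
        by (simp only: left g')
      also have "\<dots> = (\<Sum>x\<in>F'. \<Sum>y\<in>G'. cnj (c' x) * d' y * K x y)"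
        by (simp only: right f')
      finally show "(\<Sum>x\<in>F. cnj (c x) * g x)
          = (\<Sum>x\<in>F'. \<Sum>y\<in>G'. cnj (c' x) * d' y * K x y)" .
    qed
  next
    fix z
    assume "\<forall>F' c' G' d'. finite F' \<and> finite G' \<and> kernel_comb K F c = kernel_comb K F' c' \<and>
        g = kernel_comb K G' d' \<longrightarrow> z = (\<Sum>x\<in>F'. \<Sum>y\<in>G'. cnj (c' x) * d' y * K x y)"
    then have "z = (\<Sum>x\<in>F. \<Sum>y\<in>G. cnj (c x) * d y * K x y)"
      using G \<open>finite F\<close> by blast
    then show "z = (\<Sum>x\<in>F. cnj (c x) * g x)"
      by (simp only: left G)
  qed
qed

lemma kernel_span_inner_section:
  "g \<in> kernel_span K \<Longrightarrow> kernel_span_inner K (\<lambda>z. K z y) g = g y"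
  using kernel_span_inner_comb_left[of "{y}" g "\<lambda>_. 1"] by (simp add: kernel_comb_def)

lemma kernel_span_inner_Hermitian:
  assumes "f \<in> kernel_span K" "g \<in> kernel_span K"
  shows "kernel_span_inner K g f = cnj (kernel_span_inner K f g)"
proof -
  obtain F c where F: "finite F" "f = kernel_comb K F c"
    using assms by (auto simp: kernel_span_def)
  obtain G d where G: "finite G" "g = kernel_comb K G d"
    using assms by (auto simp: kernel_span_def)
  have "kernel_span_inner K g f = (\<Sum>y\<in>G. \<Sum>x\<in>F. cnj (d y) * (c x * K y x))"
    unfolding G using kernel_span_inner_comb_left[OF G(1) assms(1), of d]
    by (simp add: F(2) kernel_comb_def sum_distrib_left)
  also have "\<dots> = (\<Sum>x\<in>F. \<Sum>y\<in>G. cnj (d y) * (c x * cnj (K x y)))"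
    by (subst sum.swap) (simp flip: pd_kernel_Hermitian[OF pd])
  also have "\<dots> = cnj (\<Sum>x\<in>F. cnj (c x) * g x)"
    by (simp add: G(2) kernel_comb_def sum_distrib_left mult.left_commute)
  also have "(\<Sum>x\<in>F. cnj (c x) * g x) = kernel_span_inner K f g"
    unfolding F by (rule kernel_span_inner_comb_left[OF F(1) assms(2), symmetric])
  finally show ?thesis .
qed

lemma kernel_span_inner_add_right:
  assumes "f \<in> kernel_span K" "g \<in> kernel_span K" "h \<in> kernel_span K"
  shows "kernel_span_inner K f (g + h) = kernel_span_inner K f g + kernel_span_inner K f h"
proof -
  obtain F c where "finite F" "f = kernel_comb K F c"
    using assms by (auto simp: kernel_span_def)
  with assms show ?thesis
    by (simp add: kernel_span_inner_comb_left kernel_span_add sum.distrib algebra_simps)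
qed

lemma kernel_span_inner_diff_right:
  assumes "f \<in> kernel_span K" "g \<in> kernel_span K" "h \<in> kernel_span K"
  shows "kernel_span_inner K f (g - h) = kernel_span_inner K f g - kernel_span_inner K f h"
  using kernel_span_inner_add_right[OF assms(1) kernel_span_diff[OF assms(2,3)] assms(3)] by simp

lemma kernel_span_inner_scale_right:
  assumes "f \<in> kernel_span K" "g \<in> kernel_span K"
  shows "kernel_span_inner K f (\<lambda>y. a * g y) = a * kernel_span_inner K f g"
proof -
  obtain F c where "finite F" "f = kernel_comb K F c"
    using assms by (auto simp: kernel_span_def)
  with assms show ?thesis
    by (simp add: kernel_span_inner_comb_left kernel_span_scale sum_distrib_left mult.left_commute)
qed

lemma kernel_span_inner_add_left:
  assumes "f \<in> kernel_span K" "g \<in> kernel_span K" "h \<in> kernel_span K"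
  shows "kernel_span_inner K (g + h) f = kernel_span_inner K g f + kernel_span_inner K h f"
  using assms
  by (simp add: kernel_span_inner_Hermitian[of f] kernel_span_inner_add_right kernel_span_add)

lemma kernel_span_inner_diff_left:
  assumes "f \<in> kernel_span K" "g \<in> kernel_span K" "h \<in> kernel_span K"
  shows "kernel_span_inner K (g - h) f = kernel_span_inner K g f - kernel_span_inner K h f"
  using assms
  by (simp add: kernel_span_inner_Hermitian[of f] kernel_span_inner_diff_right kernel_span_diff)

lemma kernel_span_inner_scale_left:
  assumes "f \<in> kernel_span K" "g \<in> kernel_span K"
  shows "kernel_span_inner K (\<lambda>y. a * g y) f = cnj a * kernel_span_inner K g f"
  using assms
  by (simp add: kernel_span_inner_Hermitian[of f] kernel_span_inner_scale_right kernel_span_scale)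

lemma kernel_span_inner_self:
  assumes "f \<in> kernel_span K"
  shows "kernel_span_inner K f f = of_real ((kernel_span_norm K f)\<^sup>2)"
proof -
  obtain F c where F: "finite F" "f = kernel_comb K F c"
    using assms by (auto simp: kernel_span_def)
  have "kernel_span_inner K f f = (\<Sum>x\<in>F. \<Sum>y\<in>F. cnj (c x) * c y * K x y)"
    unfolding F using kernel_span_inner_comb_left[OF F(1) kernel_comb_in_span[OF F(1)], of c c]
    by (simp add: kernel_comb_def sum_distrib_left mult.assoc)
  then have "kernel_span_inner K f f \<in> \<real>\<^sub>\<ge>\<^sub>0"
    using pd_kernel_sum_nonneg[OF pd F(1)] by simp
  then show ?thesis
    by (simp add: kernel_span_norm_def complex_nonneg_Reals_iff complex_eq_iff)
qed

lemma kernel_span_norm_nonneg: "f \<in> kernel_span K \<Longrightarrow> 0 \<le> kernel_span_norm K f"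
proof -
  assume "f \<in> kernel_span K"
  then have "0 \<le> Re (kernel_span_inner K f f)"
    by (simp only: kernel_span_inner_self Re_complex_of_real zero_le_power2)
  then show ?thesis
    by (simp add: kernel_span_norm_def)
qed

lemma kernel_span_norm_add_sq:
  assumes "f \<in> kernel_span K" "g \<in> kernel_span K"
  shows "(kernel_span_norm K (f + g))\<^sup>2
    = (kernel_span_norm K f)\<^sup>2 + 2 * Re (kernel_span_inner K f g) + (kernel_span_norm K g)\<^sup>2"
proof -
  have "of_real ((kernel_span_norm K (f + g))\<^sup>2) = kernel_span_inner K (f + g) (f + g)"
    using assms by (simp only: kernel_span_inner_self kernel_span_add)
  also have "\<dots> = kernel_span_inner K f f + kernel_span_inner K f g
      + cnj (kernel_span_inner K f g) + kernel_span_inner K g g"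
    using assms by (simp add: kernel_span_inner_add_left kernel_span_inner_add_right kernel_span_add
        flip: kernel_span_inner_Hermitian)
  finally have "Re (of_real ((kernel_span_norm K (f + g))\<^sup>2)) = Re (kernel_span_inner K f f
      + kernel_span_inner K f g + cnj (kernel_span_inner K f g) + kernel_span_inner K g g)"
    by simp
  then show ?thesis
    using assms by (simp add: kernel_span_inner_self)
qed

lemma kernel_span_norm_scale:
  assumes "f \<in> kernel_span K"
  shows "kernel_span_norm K (\<lambda>y. a * f y) = cmod a * kernel_span_norm K f"
proof -
  have "kernel_span_inner K (\<lambda>y. a * f y) (\<lambda>y. a * f y) = (a * cnj a) * kernel_span_inner K f f"
    using assms
    by (simp add: kernel_span_inner_scale_left kernel_span_inner_scale_right kernel_span_scale)
  also have "\<dots> = of_real ((cmod a * kernel_span_norm K f)\<^sup>2)"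
    using assms
    by (simp add: kernel_span_inner_self complex_norm_square[symmetric] power_mult_distrib)
  finally show ?thesis
    using kernel_span_norm_nonneg[OF assms]
    by (subst kernel_span_norm_def) (simp add: real_sqrt_abs)
qed

lemma kernel_span_Cauchy_Schwarz:
  assumes f: "f \<in> kernel_span K" and g: "g \<in> kernel_span K"
  shows "cmod (kernel_span_inner K f g) \<le> kernel_span_norm K f * kernel_span_norm K g"
proof -
  define s where "s = cmod (kernel_span_inner K f g)"
  define p where "p = kernel_span_norm K f"
  define q where "q = kernel_span_norm K g"
  have nonneg: "0 \<le> p" "0 \<le> q" "0 \<le> s"
    by (simp_all add: p_def q_def s_def kernel_span_norm_nonneg f g)
  \<comment> \<open>Expand the squared norm of \<open>f - r * w * g\<close>, where the phase \<open>w\<close> makes the inner product of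
    \<open>f\<close> and \<open>w * g\<close> equal to \<open>s\<close>.\<close>
  have quad: "0 \<le> p\<^sup>2 - 2 * r * s + r\<^sup>2 * q\<^sup>2" for r :: real
  proof (cases "s = 0")
    case False
    define w where "w = cnj (kernel_span_inner K f g) / of_real s"
    have "w * kernel_span_inner K f g = of_real s"
      using False by (simp add: w_def s_def complex_norm_square[symmetric]
          mult.commute[of "cnj _"] power2_eq_square)
    moreover have "cmod w = 1"
      using False by (simp add: w_def s_def norm_divide)
    ultimately have "(kernel_span_norm K (f + (\<lambda>y. (of_real (- r) * w) * g y)))\<^sup>2
        = p\<^sup>2 - 2 * r * s + r\<^sup>2 * q\<^sup>2"
      using f g by (simp add: kernel_span_norm_add_sq kernel_span_scale kernel_span_inner_scale_right
          kernel_span_norm_scale norm_mult p_def q_def power_mult_distrib mult.assoc del: of_real_minus)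
    then show ?thesis
      by (metis zero_le_power2)
  qed simp
  have "s \<le> p * q"
  proof (cases "q = 0")
    case True
    \<comment> \<open>The quadratic is then affine in \<open>r\<close>, so its slope \<open>s\<close> must vanish.\<close>
    have "s = 0"
    proof (rule ccontr)
      assume "s \<noteq> 0"
      then show False
        using quad[of "(p\<^sup>2 + 1) / (2 * s)"] True by simp
    qed
    then show ?thesis
      using nonneg by simp
  next
    case False
    have "0 \<le> p\<^sup>2 - s\<^sup>2 / q\<^sup>2"
      using quad[of "s / q\<^sup>2"] False by (simp add: field_simps power2_eq_square)
    then have "s\<^sup>2 \<le> (p * q)\<^sup>2"
      using False by (simp add: field_simps power_mult_distrib)
    then show ?thesis
      using nonneg power2_le_imp_le by auto
  qed
  then show ?thesis
    by (simp add: s_def p_def q_def)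
qed

lemma kernel_span_norm_triangle:
  assumes "f \<in> kernel_span K" "g \<in> kernel_span K"
  shows "kernel_span_norm K (f + g) \<le> kernel_span_norm K f + kernel_span_norm K g"
proof (rule power2_le_imp_le)
  have "Re (kernel_span_inner K f g) \<le> kernel_span_norm K f * kernel_span_norm K g"
    using kernel_span_Cauchy_Schwarz[OF assms] complex_Re_le_cmod order_trans by blast
  then show "(kernel_span_norm K (f + g))\<^sup>2 \<le> (kernel_span_norm K f + kernel_span_norm K g)\<^sup>2"
    by (simp add: kernel_span_norm_add_sq[OF assms] power2_sum)
qed (simp add: assms kernel_span_norm_nonneg)

section \<open>Cauchy sequences in the span\<close>

lemma kernel_span_Cauchy_in: "kernel_span_Cauchy K u \<Longrightarrow> u n \<in> kernel_span K"
  by (auto simp: kernel_span_Cauchy_def)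

lemma kernel_span_CauchyD:
  assumes "kernel_span_Cauchy K u" "0 < e"
  obtains M where "\<And>m n. m \<ge> M \<Longrightarrow> n \<ge> M \<Longrightarrow> kernel_span_norm K (u m - u n) < e"
  using assms unfolding kernel_span_Cauchy_def by meson

lemma kernel_span_Cauchy_bounded:
  assumes u: "kernel_span_Cauchy K u"
  obtains B where "0 < B" "\<And>n. kernel_span_norm K (u n) \<le> B"
proof -
  obtain M where M: "\<And>m n. m \<ge> M \<Longrightarrow> n \<ge> M \<Longrightarrow> kernel_span_norm K (u m - u n) < 1"
    using kernel_span_CauchyD[OF u, of 1] by auto
  define C where "C = Max ((\<lambda>n. kernel_span_norm K (u n)) ` {..M})"
  have C: "kernel_span_norm K (u n) \<le> C" if "n \<le> M" for n
    unfolding C_def using that by (intro Max_ge) auto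
  have "0 \<le> C"
    using C[of M] kernel_span_norm_nonneg[OF kernel_span_Cauchy_in[OF u, of M]] by simp
  moreover have "kernel_span_norm K (u n) \<le> 1 + C" for n
  proof (cases "n \<le> M")
    case False
    have "kernel_span_norm K ((u n - u M) + u M)
        \<le> kernel_span_norm K (u n - u M) + kernel_span_norm K (u M)"
      by (intro kernel_span_norm_triangle kernel_span_diff kernel_span_Cauchy_in[OF u])
    then show ?thesis
      using M[of n M] C[of M] False by simp
  qed (use C[of n] in simp)
  ultimately show ?thesis
    using that[of "1 + C"] by simp
qed

lemma kernel_span_Cauchy_const: "f \<in> kernel_span K \<Longrightarrow> kernel_span_Cauchy K (\<lambda>_. f)"
  by (auto simp: kernel_span_Cauchy_def kernel_span_norm_def zero_fun_def
      kernel_span_norm_scale[of f 0, unfolded kernel_span_norm_def, simplified])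

lemma kernel_span_Cauchy_add:
  assumes u: "kernel_span_Cauchy K u" and v: "kernel_span_Cauchy K v"
  shows "kernel_span_Cauchy K (\<lambda>n. u n + v n)"
  unfolding kernel_span_Cauchy_def
proof (intro conjI allI impI)
  show "range (\<lambda>n. u n + v n) \<subseteq> kernel_span K"
    using u v by (auto intro: kernel_span_add kernel_span_Cauchy_in)
  fix e :: real assume "0 < e"
  then obtain M N where
      M: "\<And>m n. m \<ge> M \<Longrightarrow> n \<ge> M \<Longrightarrow> kernel_span_norm K (u m - u n) < e / 2" and
      N: "\<And>m n. m \<ge> N \<Longrightarrow> n \<ge> N \<Longrightarrow> kernel_span_norm K (v m - v n) < e / 2"
    using kernel_span_CauchyD[OF u, of "e / 2"] kernel_span_CauchyD[OF v, of "e / 2"]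
    by (metis half_gt_zero)
  have "kernel_span_norm K ((u m + v m) - (u n + v n)) < e" if "m \<ge> max M N" "n \<ge> max M N" for m n
  proof -
    have "kernel_span_norm K ((u m + v m) - (u n + v n))
        = kernel_span_norm K ((u m - u n) + (v m - v n))"
      by (simp only: add_diff_add)
    also have "\<dots> \<le> kernel_span_norm K (u m - u n) + kernel_span_norm K (v m - v n)"
      by (intro kernel_span_norm_triangle kernel_span_diff kernel_span_Cauchy_in[OF u]
          kernel_span_Cauchy_in[OF v])
    finally show ?thesis
      using M[of m n] N[of m n] that by simp
  qed
  then show "\<exists>M. \<forall>m\<ge>M. \<forall>n\<ge>M. kernel_span_norm K ((u m + v m) - (u n + v n)) < e"
    by blast
qed

lemma kernel_span_Cauchy_scale:
  assumes u: "kernel_span_Cauchy K u"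
  shows "kernel_span_Cauchy K (\<lambda>n y. a * u n y)"
  unfolding kernel_span_Cauchy_def
proof (intro conjI allI impI)
  show "range (\<lambda>n y. a * u n y) \<subseteq> kernel_span K"
    using u by (auto intro: kernel_span_scale kernel_span_Cauchy_in)
  fix e :: real assume "0 < e"
  \<comment> \<open>The summand \<open>1\<close> keeps the denominator positive when \<open>a = 0\<close>.\<close>
  then obtain M where
      M: "\<And>m n. m \<ge> M \<Longrightarrow> n \<ge> M \<Longrightarrow> kernel_span_norm K (u m - u n) < e / (cmod a + 1)"
    using kernel_span_CauchyD[OF u, of "e / (cmod a + 1)"]
    by (metis add_nonneg_pos divide_pos_pos norm_ge_zero zero_less_one)
  have "kernel_span_norm K ((\<lambda>y. a * u m y) - (\<lambda>y. a * u n y)) < e" if "m \<ge> M" "n \<ge> M" for m n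
  proof -
    have diff: "u m - u n \<in> kernel_span K"
      by (intro kernel_span_diff kernel_span_Cauchy_in[OF u])
    have "(\<lambda>y. a * u m y) - (\<lambda>y. a * u n y) = (\<lambda>y. a * (u m - u n) y)"
      by (simp add: fun_eq_iff right_diff_distrib)
    then have "kernel_span_norm K ((\<lambda>y. a * u m y) - (\<lambda>y. a * u n y))
        = cmod a * kernel_span_norm K (u m - u n)"
      by (simp only: kernel_span_norm_scale[OF diff])
    also have "\<dots> \<le> (cmod a + 1) * kernel_span_norm K (u m - u n)"
      by (intro mult_right_mono) (simp_all add: kernel_span_norm_nonneg diff)
    also have "\<dots> < (cmod a + 1) * (e / (cmod a + 1))"
      using M[OF that] by (intro mult_strict_left_mono) (simp_all add: add_nonneg_pos)
    also have "\<dots> = e"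
      by (simp add: add_nonneg_eq_0_iff)
    finally show ?thesis .
  qed
  then show "\<exists>M. \<forall>m\<ge>M. \<forall>n\<ge>M. kernel_span_norm K ((\<lambda>y. a * u m y) - (\<lambda>y. a * u n y)) < e"
    by blast
qed

lemma kernel_span_Cauchy_diff:
  assumes u: "kernel_span_Cauchy K u" and v: "kernel_span_Cauchy K v"
  shows "kernel_span_Cauchy K (\<lambda>n. u n - v n)"
proof -
  have "(\<lambda>n. u n - v n) = (\<lambda>n. u n + (\<lambda>y. - 1 * v n y))"
    by (simp add: fun_eq_iff)
  then show ?thesis
    using kernel_span_Cauchy_add[OF u kernel_span_Cauchy_scale[OF v, of "- 1"]] by simp
qed

lemma kernel_span_inner_convergent:
  assumes u: "kernel_span_Cauchy K u" and v: "kernel_span_Cauchy K v"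
  shows "convergent (\<lambda>n. kernel_span_inner K (u n) (v n))"
proof (intro Cauchy_convergent metric_CauchyI)
  fix e :: real assume "0 < e"
  obtain B where B: "0 < B" "\<And>n. kernel_span_norm K (u n) \<le> B"
    using kernel_span_Cauchy_bounded[OF u] by blast
  obtain C where C: "0 < C" "\<And>n. kernel_span_norm K (v n) \<le> C"
    using kernel_span_Cauchy_bounded[OF v] by blast
  obtain M where M: "\<And>m n. m \<ge> M \<Longrightarrow> n \<ge> M \<Longrightarrow> kernel_span_norm K (u m - u n) < e / (2 * C)"
    using kernel_span_CauchyD[OF u, of "e / (2 * C)"] \<open>0 < e\<close> C by auto
  obtain N where N: "\<And>m n. m \<ge> N \<Longrightarrow> n \<ge> N \<Longrightarrow> kernel_span_norm K (v m - v n) < e / (2 * B)"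
    using kernel_span_CauchyD[OF v, of "e / (2 * B)"] \<open>0 < e\<close> B by auto
  note in_span = kernel_span_Cauchy_in[OF u] kernel_span_Cauchy_in[OF v] kernel_span_diff
  have "dist (kernel_span_inner K (u m) (v m)) (kernel_span_inner K (u n) (v n)) < e"
    if "m \<ge> max M N" "n \<ge> max M N" for m n
  proof -
    have "kernel_span_inner K (u m) (v m) - kernel_span_inner K (u n) (v n)
        = kernel_span_inner K (u m - u n) (v m) + kernel_span_inner K (u n) (v m - v n)"
      by (simp add: kernel_span_inner_diff_left kernel_span_inner_diff_right in_span)
    also have "cmod \<dots> \<le> cmod (kernel_span_inner K (u m - u n) (v m))
        + cmod (kernel_span_inner K (u n) (v m - v n))"
      by (rule norm_triangle_ineq)
    also have "\<dots> \<le> kernel_span_norm K (u m - u n) * kernel_span_norm K (v m)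
        + kernel_span_norm K (u n) * kernel_span_norm K (v m - v n)"
      by (intro add_mono kernel_span_Cauchy_Schwarz in_span)
    also have "\<dots> \<le> kernel_span_norm K (u m - u n) * C + B * kernel_span_norm K (v m - v n)"
      using B C by (intro add_mono mult_left_mono mult_right_mono kernel_span_norm_nonneg in_span)
    also have "\<dots> < e / (2 * C) * C + B * (e / (2 * B))"
      using M[of m n] N[of m n] that B C
      by (intro add_strict_mono mult_strict_right_mono mult_strict_left_mono) auto
    also have "\<dots> = e"
      using B C by simp
    finally show ?thesis
      by (simp add: dist_norm)
  qed
  then show "\<exists>M. \<forall>m\<ge>M. \<forall>n\<ge>M.
      dist (kernel_span_inner K (u m) (v m)) (kernel_span_inner K (u n) (v n)) < e"
    by blast
qed

text \<open>Pointwise convergence to \<open>0\<close> forces weak convergence to \<open>0\<close>: against a fixed \<open>v m\<close>, a finite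
  combination of kernel sections, the inner product is a finite combination of values of \<open>u n\<close>; and
  replacing \<open>v n\<close> by \<open>v m\<close> costs at most the bound on the norms of \<open>u\<close> times the norm of
  \<open>v n - v m\<close>.\<close>

lemma inner_tendsto_0:
  assumes u: "kernel_span_Cauchy K u" and v: "kernel_span_Cauchy K v"
    and 0: "\<And>y. (\<lambda>n. u n y) \<longlonglongrightarrow> 0"
  shows "(\<lambda>n. kernel_span_inner K (v n) (u n)) \<longlonglongrightarrow> 0"
proof (rule LIMSEQ_I)
  fix e :: real assume "0 < e"
  note in_span = kernel_span_Cauchy_in[OF u] kernel_span_Cauchy_in[OF v] kernel_span_diff
  obtain B where B: "0 < B" "\<And>n. kernel_span_norm K (u n) \<le> B"
    using kernel_span_Cauchy_bounded[OF u] by blast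
  obtain M where M: "\<And>m n. m \<ge> M \<Longrightarrow> n \<ge> M \<Longrightarrow> kernel_span_norm K (v m - v n) < e / (2 * B)"
    using kernel_span_CauchyD[OF v, of "e / (2 * B)"] \<open>0 < e\<close> B by auto
  obtain F c where F: "finite F" "v M = kernel_comb K F c"
    using in_span(2)[of M] by (auto simp: kernel_span_def)
  have "(\<lambda>n. \<Sum>x\<in>F. cnj (c x) * u n x) \<longlonglongrightarrow> (\<Sum>x\<in>F. cnj (c x) * 0)"
    by (intro tendsto_sum tendsto_mult_left 0)
  then have "(\<lambda>n. kernel_span_inner K (v M) (u n)) \<longlonglongrightarrow> 0"
    by (simp add: F kernel_span_inner_comb_left in_span)
  then obtain N where N: "\<And>n. n \<ge> N \<Longrightarrow> cmod (kernel_span_inner K (v M) (u n)) < e / 2"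
    using LIMSEQ_D[of _ 0 "e / 2"] \<open>0 < e\<close> by fastforce
  have "cmod (kernel_span_inner K (v n) (u n)) < e" if "n \<ge> max M N" for n
  proof -
    have "kernel_span_inner K (v n) (u n)
        = kernel_span_inner K (v n - v M) (u n) + kernel_span_inner K (v M) (u n)"
      by (simp add: kernel_span_inner_diff_left in_span)
    also have "cmod \<dots> \<le> cmod (kernel_span_inner K (v n - v M) (u n))
        + cmod (kernel_span_inner K (v M) (u n))"
      by (rule norm_triangle_ineq)
    also have "\<dots> \<le> kernel_span_norm K (v n - v M) * kernel_span_norm K (u n)
        + cmod (kernel_span_inner K (v M) (u n))"
      by (intro add_right_mono kernel_span_Cauchy_Schwarz in_span)
    also have "\<dots> \<le> kernel_span_norm K (v n - v M) * B + cmod (kernel_span_inner K (v M) (u n))"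
      using B by (intro add_right_mono mult_left_mono kernel_span_norm_nonneg in_span)
    also have "\<dots> < e / (2 * B) * B + e / 2"
      using M[of n M] N[of n] that B by (intro add_strict_mono mult_strict_right_mono) auto
    also have "\<dots> = e"
      using B by simp
    finally show ?thesis .
  qed
  then show "\<exists>N. \<forall>n\<ge>N. cmod (kernel_span_inner K (v n) (u n) - 0) < e"
    by (simp only: diff_zero) blast
qed

section \<open>The completion as a space of functions\<close>

lemma rkhs_approx_Cauchy: "rkhs_approx K u f \<Longrightarrow> kernel_span_Cauchy K u"
  by (simp add: rkhs_approx_def)

lemma rkhs_approx_in_span: "rkhs_approx K u f \<Longrightarrow> u n \<in> kernel_span K"
  by (simp add: rkhs_approx_Cauchy kernel_span_Cauchy_in)

text \<open>Changing the approximating sequences one argument at a time changes the inner products by a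
  null sequence, by \<open>inner_tendsto_0\<close>. So all approximating sequences give the same limit, and the
  inner product of the completion can be computed with any of them.\<close>

lemma rkhs_inner_tendsto:
  assumes u: "rkhs_approx K u f" and v: "rkhs_approx K v g"
  shows "(\<lambda>n. kernel_span_inner K (u n) (v n)) \<longlonglongrightarrow> rkhs_inner K f g"
proof -
  obtain z where z: "(\<lambda>n. kernel_span_inner K (u n) (v n)) \<longlonglongrightarrow> z"
    using kernel_span_inner_convergent[OF rkhs_approx_Cauchy[OF u] rkhs_approx_Cauchy[OF v]]
    by (auto simp: convergent_def)
  have null: "(\<lambda>n. kernel_span_inner K (b n) (a n - a' n)) \<longlonglongrightarrow> 0"
    if "rkhs_approx K a h" "rkhs_approx K a' h" "kernel_span_Cauchy K b" for a a' b h
  proof (rule inner_tendsto_0)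
    show "(\<lambda>n. (a n - a' n) y) \<longlonglongrightarrow> 0" for y
      using that tendsto_diff[of "\<lambda>n. a n y" "h y" sequentially "\<lambda>n. a' n y" "h y"]
      by (simp add: rkhs_approx_def)
  qed (use that in \<open>auto intro: kernel_span_Cauchy_diff rkhs_approx_Cauchy\<close>)
  have all: "(\<lambda>n. kernel_span_inner K (u' n) (v' n)) \<longlonglongrightarrow> z"
    if u': "rkhs_approx K u' f" and v': "rkhs_approx K v' g" for u' v'
  proof -
    note in_span = rkhs_approx_in_span[OF u] rkhs_approx_in_span[OF v]
      rkhs_approx_in_span[OF u'] rkhs_approx_in_span[OF v'] kernel_span_diff
    have "(\<lambda>n. cnj (kernel_span_inner K (v n) (u' n - u n))) \<longlonglongrightarrow> cnj 0"
      by (intro tendsto_cnj null[OF u' u] rkhs_approx_Cauchy[OF v])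
    then have "(\<lambda>n. kernel_span_inner K (u n) (v n)
        + cnj (kernel_span_inner K (v n) (u' n - u n))
        + kernel_span_inner K (u' n) (v' n - v n)) \<longlonglongrightarrow> z + cnj 0 + 0"
      by (intro tendsto_add z null[OF v' v] rkhs_approx_Cauchy[OF u'])
    moreover have "kernel_span_inner K (u n) (v n) + cnj (kernel_span_inner K (v n) (u' n - u n))
        + kernel_span_inner K (u' n) (v' n - v n) = kernel_span_inner K (u' n) (v' n)" for n
      by (simp add: kernel_span_inner_diff_left kernel_span_inner_diff_right in_span
          flip: kernel_span_inner_Hermitian)
    ultimately show ?thesis
      by simp
  qed
  have "rkhs_inner K f g = z"
    unfolding rkhs_inner_def
  proof (rule the_equality)
    show "\<forall>u v. rkhs_approx K u f \<and> rkhs_approx K v g \<longrightarrow>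
        (\<lambda>n. kernel_span_inner K (u n) (v n)) \<longlonglongrightarrow> z"
      using all by blast
  next
    fix z'
    assume "\<forall>u v. rkhs_approx K u f \<and> rkhs_approx K v g \<longrightarrow>
        (\<lambda>n. kernel_span_inner K (u n) (v n)) \<longlonglongrightarrow> z'"
    then show "z' = z"
      using u v z LIMSEQ_unique by blast
  qed
  with z show ?thesis
    by simp
qed

lemma rkhs_approx_const: "f \<in> kernel_span K \<Longrightarrow> rkhs_approx K (\<lambda>_. f) f"
  by (simp add: rkhs_approx_def kernel_span_Cauchy_const)

lemma rkhs_approx_add:
  "rkhs_approx K u f \<Longrightarrow> rkhs_approx K v g \<Longrightarrow> rkhs_approx K (\<lambda>n. u n + v n) (f + g)"
  by (auto simp: rkhs_approx_def intro: kernel_span_Cauchy_add tendsto_add)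

lemma rkhs_approx_scale:
  "rkhs_approx K u f \<Longrightarrow> rkhs_approx K (\<lambda>n y. a * u n y) (\<lambda>y. a * f y)"
  by (auto simp: rkhs_approx_def intro: kernel_span_Cauchy_scale tendsto_mult_left)

lemma kernel_span_subset_rkhs: "f \<in> kernel_span K \<Longrightarrow> f \<in> rkhs K"
  using rkhs_approx_const by (auto simp: rkhs_def)

lemma rkhs_add: "f \<in> rkhs K \<Longrightarrow> g \<in> rkhs K \<Longrightarrow> f + g \<in> rkhs K"
  unfolding rkhs_def using rkhs_approx_add by blast

lemma rkhs_scale: "f \<in> rkhs K \<Longrightarrow> (\<lambda>y. a * f y) \<in> rkhs K"
  unfolding rkhs_def using rkhs_approx_scale by blast

lemma rkhs_zero: "0 \<in> rkhs K"
  using kernel_span_subset_rkhs[OF kernel_comb_in_span[of "{}" K]]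
  by (simp add: kernel_comb_def zero_fun_def)

lemma rkhs_inner_Hermitian:
  assumes "f \<in> rkhs K" "g \<in> rkhs K"
  shows "rkhs_inner K g f = cnj (rkhs_inner K f g)"
proof -
  obtain u v where u: "rkhs_approx K u f" and v: "rkhs_approx K v g"
    using assms by (auto simp: rkhs_def)
  have "(\<lambda>n. kernel_span_inner K (v n) (u n)) \<longlonglongrightarrow> cnj (rkhs_inner K f g)"
    using tendsto_cnj[OF rkhs_inner_tendsto[OF u v]] u v
    by (simp add: rkhs_approx_in_span flip: kernel_span_inner_Hermitian)
  then show ?thesis
    using rkhs_inner_tendsto[OF v u] LIMSEQ_unique by blast
qed

lemma rkhs_inner_add_right:
  assumes "f \<in> rkhs K" "g \<in> rkhs K" "h \<in> rkhs K"
  shows "rkhs_inner K f (g + h) = rkhs_inner K f g + rkhs_inner K f h"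
proof -
  obtain u v w where u: "rkhs_approx K u f" and v: "rkhs_approx K v g" and w: "rkhs_approx K w h"
    using assms by (auto simp: rkhs_def)
  have "(\<lambda>n. kernel_span_inner K (u n) (v n + w n)) \<longlonglongrightarrow> rkhs_inner K f g + rkhs_inner K f h"
    using tendsto_add[OF rkhs_inner_tendsto[OF u v] rkhs_inner_tendsto[OF u w]] u v w
    by (simp add: rkhs_approx_in_span kernel_span_inner_add_right)
  then show ?thesis
    using rkhs_inner_tendsto[OF u rkhs_approx_add[OF v w]] LIMSEQ_unique by blast
qed

lemma rkhs_inner_scale_right:
  assumes "f \<in> rkhs K" "g \<in> rkhs K"
  shows "rkhs_inner K f (\<lambda>y. a * g y) = a * rkhs_inner K f g"
proof -
  obtain u v where u: "rkhs_approx K u f" and v: "rkhs_approx K v g"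
    using assms by (auto simp: rkhs_def)
  have "(\<lambda>n. kernel_span_inner K (u n) (\<lambda>y. a * v n y)) \<longlonglongrightarrow> a * rkhs_inner K f g"
    using tendsto_mult_left[OF rkhs_inner_tendsto[OF u v], of a] u v
    by (simp add: rkhs_approx_in_span kernel_span_inner_scale_right)
  then show ?thesis
    using rkhs_inner_tendsto[OF u rkhs_approx_scale[OF v]] LIMSEQ_unique by blast
qed

lemma rkhs_inner_sum_right:
  assumes "finite J" "f \<in> rkhs K" "\<And>j. j \<in> J \<Longrightarrow> g j \<in> rkhs K"
  shows "rkhs_inner K f (\<Sum>j\<in>J. (\<lambda>y. a j * g j y)) = (\<Sum>j\<in>J. a j * rkhs_inner K f (g j))"
proof -
  \<comment> \<open>Additivity needs the partial sums to lie in \<open>rkhs K\<close>, so membership joins the induction.\<close>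
  have "(\<Sum>j\<in>J. (\<lambda>y. a j * g j y)) \<in> rkhs K \<and>
      rkhs_inner K f (\<Sum>j\<in>J. (\<lambda>y. a j * g j y)) = (\<Sum>j\<in>J. a j * rkhs_inner K f (g j))"
    using assms(1,3)
  proof (induction J rule: finite_induct)
    case empty
    have "rkhs_inner K f 0 = 0"
      using rkhs_inner_add_right[OF assms(2) rkhs_zero rkhs_zero] by simp
    then show ?case
      by (simp only: sum.empty rkhs_zero simp_thms)
  next
    case (insert j J)
    then have "g j \<in> rkhs K" "(\<Sum>j\<in>J. (\<lambda>y. a j * g j y)) \<in> rkhs K"
      by auto
    then show ?case
      using insert
      by (simp only: sum.insert rkhs_add rkhs_scale rkhs_inner_add_right rkhs_inner_scale_right
          assms(2) simp_thms insert_iff)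
  qed
  then show ?thesis ..
qed

lemma rkhs_reproducing:
  assumes "f \<in> rkhs K"
  shows "rkhs_inner K (\<lambda>z. K z y) f = f y"
proof -
  obtain v where v: "rkhs_approx K v f"
    using assms by (auto simp: rkhs_def)
  have "(\<lambda>n. v n y) \<longlonglongrightarrow> rkhs_inner K (\<lambda>z. K z y) f"
    using rkhs_inner_tendsto[OF rkhs_approx_const[OF kernel_section_in_span] v]
    by (simp add: kernel_span_inner_section rkhs_approx_in_span[OF v])
  then show ?thesis
    using v LIMSEQ_unique by (auto simp: rkhs_approx_def)
qed

text \<open>Elements of the completion are determined by their inner products because these include all
  point values, by the reproducing property.\<close>

lemma rkhs_eqI:
  assumes "f \<in> rkhs K" "g \<in> rkhs K" "\<And>u. u \<in> rkhs K \<Longrightarrow> rkhs_inner K u f = rkhs_inner K u g"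
  shows "f = g"
proof
  fix y
  have "(\<lambda>z. K z y) \<in> rkhs K"
    by (simp add: kernel_span_subset_rkhs kernel_section_in_span)
  then show "f y = g y"
    using assms rkhs_reproducing by metis
qed

end

section \<open>The adjoints\<close>

lemma cvec_inner_axis: "cvec_inner (axis j 1) b = b $ j"
proof -
  have "cvec_inner (axis j 1) b = (\<Sum>i\<in>UNIV. if i = j then b $ i else 0)"
    unfolding cvec_inner_def by (intro sum.cong) (auto simp: axis_def)
  then show ?thesis
    by simp
qed

lemma hilbert_adjoint_cvec_eqI:
  assumes "\<And>u. cvec_inner u v = ipW (T u) w"
  shows "hilbert_adjoint UNIV cvec_inner ipW T w = v"
  unfolding hilbert_adjoint_def
proof (rule the_equality)
  show "v \<in> UNIV \<and> (\<forall>u\<in>UNIV. cvec_inner u v = ipW (T u) w)"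
    using assms by simp
next
  fix v' assume "v' \<in> UNIV \<and> (\<forall>u\<in>UNIV. cvec_inner u v' = ipW (T u) w)"
  then have "cvec_inner (axis j 1) v' = cvec_inner (axis j 1) v" for j
    using assms by simp
  then show "v' = v"
    by (simp add: cvec_inner_axis vec_eq_iff)
qed

lemma hilbert_adjoint_rkhs_eqI:
  assumes "positive_definite_kernel K" "v \<in> rkhs K"
    and "\<And>u. u \<in> rkhs K \<Longrightarrow> rkhs_inner K u v = ipW (T u) w"
  shows "hilbert_adjoint (rkhs K) (rkhs_inner K) ipW T w = v"
  unfolding hilbert_adjoint_def
proof (rule the_equality)
  show "v \<in> rkhs K \<and> (\<forall>u\<in>rkhs K. rkhs_inner K u v = ipW (T u) w)"
    using assms by simp
next
  fix v' assume "v' \<in> rkhs K \<and> (\<forall>u\<in>rkhs K. rkhs_inner K u v' = ipW (T u) w)"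
  then show "v' = v"
    using assms by (intro rkhs_eqI) auto
qed

lemma analysis_operator_nth: "analysis_operator K \<Phi> x f $ j = rkhs_inner K (\<Phi> (x j)) f"
proof -
  have "analysis_operator K \<Phi> x f $ j
      = (\<Sum>i\<in>UNIV. if i = j then rkhs_inner K (\<Phi> (x i)) f else 0)"
    unfolding analysis_operator_def sum_component by (intro sum.cong) (auto simp: axis_def)
  then show ?thesis
    by simp
qed

theorem theorem2p14:
  fixes K :: "complex ^ 'm \<Rightarrow> complex ^ 'm \<Rightarrow> complex"
    and \<Phi> :: "complex ^ 'm \<Rightarrow> (complex ^ 'm \<Rightarrow> complex)"
    and x :: "'n::finite \<Rightarrow> complex ^ 'm"
    and L :: "(complex ^ 'm \<Rightarrow> complex) \<Rightarrow> complex ^ 'n"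
    and A :: "complex ^ 'n \<Rightarrow> (complex ^ 'm \<Rightarrow> complex)"
  assumes "positive_definite_kernel K"
    and "feature_map K \<Phi>"
    and "\<forall>f\<in>rkhs K. L f = analysis_operator K \<Phi> x f"
    and "range A \<subseteq> rkhs K"
    and "Vector_Spaces.linear (*s) (\<lambda>a f y. a * f y) A"
    and "\<forall>j. A (axis j 1) = \<Phi> (x j)"
  shows "(\<forall>h\<in>rkhs K. hilbert_adjoint UNIV cvec_inner (rkhs_inner K) A h
            = (\<chi> j. rkhs_inner K (\<Phi> (x j)) h))
    \<and> A = hilbert_adjoint (rkhs K) (rkhs_inner K) cvec_inner L
    \<and> (\<forall>h\<in>rkhs K. hilbert_adjoint UNIV cvec_inner (rkhs_inner K) A h = L h)"
proof -
  note pd = assms(1)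
  interpret A: Vector_Spaces.linear "(*s)" "\<lambda>a f y. a * f y" A
    by (fact assms(5))
  have \<Phi>: "\<Phi> y \<in> rkhs K" for y
    using assms(2) by (auto simp: feature_map_def)
  have A_rkhs: "A a \<in> rkhs K" for a
    using assms(4) by auto
  have L: "L h = (\<chi> j. rkhs_inner K (\<Phi> (x j)) h)" if "h \<in> rkhs K" for h
    using assms(3) that by (simp add: vec_eq_iff analysis_operator_nth)
  have A: "A a = (\<Sum>j\<in>UNIV. (\<lambda>y. a $ j * \<Phi> (x j) y))" for a
  proof -
    have "A a = A (\<Sum>j\<in>UNIV. a $ j *s axis j 1)"
      by (simp add: basis_expansion)
    also have "\<dots> = (\<Sum>j\<in>UNIV. (\<lambda>y. a $ j * A (axis j 1) y))"
      by (simp only: A.sum A.scale)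
    finally show ?thesis
      using assms(6) by simp
  qed
  have adjoint: "rkhs_inner K h (A a) = cvec_inner (L h) a" if h: "h \<in> rkhs K" for h a
  proof -
    have "rkhs_inner K h (A a) = (\<Sum>j\<in>UNIV. a $ j * rkhs_inner K h (\<Phi> (x j)))"
      unfolding A by (intro rkhs_inner_sum_right[OF pd]) (auto simp: h \<Phi>)
    also have "\<dots> = cvec_inner (L h) a"
      unfolding cvec_inner_def L[OF h]
      by (simp add: rkhs_inner_Hermitian[OF pd \<Phi> h] mult.commute)
    finally show ?thesis .
  qed
  have A_adjoint: "hilbert_adjoint UNIV cvec_inner (rkhs_inner K) A h = L h"
    if h: "h \<in> rkhs K" for h
  proof (rule hilbert_adjoint_cvec_eqI)
    fix a
    have "cvec_inner a (L h) = cnj (cvec_inner (L h) a)"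
      by (simp add: cvec_inner_def mult.commute)
    also have "\<dots> = rkhs_inner K (A a) h"
      by (simp add: adjoint[OF h, symmetric] rkhs_inner_Hermitian[OF pd h A_rkhs])
    finally show "cvec_inner a (L h) = rkhs_inner K (A a) h" .
  qed
  have L_adjoint: "hilbert_adjoint (rkhs K) (rkhs_inner K) cvec_inner L a = A a" for a
    using hilbert_adjoint_rkhs_eqI[OF pd A_rkhs, of a cvec_inner L a] adjoint by blast
  show ?thesis
    using A_adjoint L L_adjoint by auto
qed

end
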